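(* Define vectors of polynomials in an indeterminate $\rho$ recursively by $\mathbf{x}_1(\rho) = [1]$ and, for $n \ge 1$, $$\mathbf{x}_{n+1}(\rho) = \begin{bmatrix} \rho\, C_n(\rho)\,\mathbf{x}_n(\rho) \\ C_n(\rho) \\ \mathbf{x}_n(\rho)\end{bmatrix},$$ so that $\mathbf{x}_{n+1}(\rho)$ has dimension $2^{n+1}-1$. Then for every $n \ge 1$, the solution $\mathbf{y}$, normalized so that its final component is $1$, of the eigenvector equation $\mathbf{M}_{n+1}\mathbf{y} = \rho_{n+1}\mathbf{y}$, i.e. $$\begin{bmatrix} \mathbf{M}_n & \mathbf{0} & \mathbf{e}_1\mathbf{e}_{d_n}^T \\ \mathbf{e}_{d_n}^T & 0 & \mathbf{0} \\ \mathbf{0} & \mathbf{e}_1 & \mathbf{M}_n \end{bmatrix}\mathbf{y} = \rho_{n+1}\,\mathbf{y},$$ is $$\mathbf{y} = \mathbf{x}_{n+1}(\rho_{n+1}) = \begin{bmatrix} \rho_{n+1} C_n(\rho_{n+1})\,\mathbf{x}_n(\rho_{n+1}) \\ C_n(\rho_{n+1}) \\ \mathbf{x}_n(\rho_{n+1})\end{bmatrix}.$$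
   Context: Let $d_n = 2^n-1$. The Mandelbrot matrices $\mathbf{M}_n$ (of size $d_n\times d_n$) are defined by $\mathbf{M}_1=[1]$ and, for $n\ge 1$, $$\mathbf{M}_{n+1} = \begin{bmatrix} \mathbf{M}_n & \mathbf{0} & \mathbf{e}_1\mathbf{e}_{d_n}^T \\ \mathbf{e}_{d_n}^T & 0 & \mathbf{0} \\ \mathbf{0} & \mathbf{e}_1 & \mathbf{M}_n \end{bmatrix},$$ where $\mathbf{e}_1$ and $\mathbf{e}_{d_n}$ are the first and last standard basis column vectors of dimension $d_n$, and the middle row and column have size $1$. The characteristic polynomial is $C_n(\lambda) = \det(\lambda \mathbf{I} - \mathbf{M}_n)$; it satisfies $C_{n+1}(\lambda) = \lambda C_n(\lambda)^2 - 1$ with $C_0=1$. Each $\mathbf{M}_n$ is a nonnegative irreducible matrix, and $\rho_n$ denotes its dominant (Perron--Frobenius) eigenvalue, i.e. its unique eigenvalue of largest absolute value, which is real, positive and simple. *)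

theory Defs
  imports Complex_Main "Jordan_Normal_Form.Char_Poly"
begin

definition d :: "nat \<Rightarrow> nat" where
  "d n = 2 ^ n - 1"

text \<open>
  Indices start at \<open>0\<close>, so the first and last standard basis vectors of dimension \<open>m\<close> are
  \<open>unit_vec m 0\<close> and \<open>unit_vec m (m - 1)\<close>; they are used here as \<open>m \<times> 1\<close> columns and
  \<open>1 \<times> m\<close> rows.
\<close>

definition col_e1 :: "nat \<Rightarrow> complex mat" where
  "col_e1 m = mat_of_cols m [unit_vec m 0]"

definition row_e_last :: "nat \<Rightarrow> complex mat" where
  "row_e_last m = mat_of_rows m [unit_vec m (m - 1)]"

text \<open>
  The \<open>3 \<times> 3\<close> block matrix is built from \<open>2 \<times> 2\<close> blocks, splitting after the middle row and
  column. The value at \<open>0\<close>, the empty matrix, lies outside the family proper; its characteristic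
  polynomial is \<open>1\<close>.
\<close>

fun mandelbrot_mat :: "nat \<Rightarrow> complex mat" where
  "mandelbrot_mat 0 = 1\<^sub>m 0"
| "mandelbrot_mat (Suc 0) = 1\<^sub>m 1"
| "mandelbrot_mat (Suc (Suc k)) =
    (let M = mandelbrot_mat (Suc k); m = d (Suc k) in
      four_block_mat
        (four_block_mat M (0\<^sub>m m 1) (row_e_last m) (0\<^sub>m 1 1))
        (col_e1 m * row_e_last m @\<^sub>r 0\<^sub>m 1 m)
        (four_block_mat (0\<^sub>m m m) (col_e1 m) (0\<^sub>m 0 m) (0\<^sub>m 0 1))
        M)"

definition C :: "nat \<Rightarrow> complex poly" where
  "C n = char_poly (mandelbrot_mat n)"

definition is_dominant_eigenvalue :: "complex mat \<Rightarrow> complex \<Rightarrow> bool" where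
  "is_dominant_eigenvalue A r \<longleftrightarrow>
    eigenvalue A r \<and> (\<forall>s. eigenvalue A s \<and> s \<noteq> r \<longrightarrow> cmod s < cmod r)"

definition \<rho> :: "nat \<Rightarrow> complex" where
  "\<rho> n = (THE r. is_dominant_eigenvalue (mandelbrot_mat n) r)"

text \<open>
  The entries are polynomials; \<open>[:0, 1:]\<close> is the indeterminate. The value at \<open>0\<close> is again a dummy.
\<close>

fun xvec :: "nat \<Rightarrow> complex poly vec" where
  "xvec 0 = 0\<^sub>v 0"
| "xvec (Suc 0) = vec_of_list [1]"
| "xvec (Suc (Suc k)) =
    ([:0, 1:] * C (Suc k)) \<cdot>\<^sub>v xvec (Suc k) @\<^sub>v vec_of_list [C (Suc k)] @\<^sub>v xvec (Suc k)"

definition eval_vec :: "'a :: comm_semiring_0 poly vec \<Rightarrow> 'a \<Rightarrow> 'a vec" where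
  "eval_vec v r = map_vec (\<lambda>p. poly p r) v"

end

theory Submission
  imports Defs
begin

text \<open>
  Write \<open>x(z)\<close> for the value of \<open>xvec n\<close> at \<open>z\<close> and \<open>e\<^sub>1\<close> for the first unit vector. The heart of
  the matter is the identity
  \<open>(z I - M\<^sub>n) x(z) = C\<^sub>n(z) e\<^sub>1\<close> (lemma \<open>mandelbrot_mat_mult_xvec\<close>), valid for every complex \<open>z\<close>:
  at a root of \<open>C\<^sub>n\<close> it says that \<open>x(z)\<close> is an eigenvector, and its last entry is \<open>1\<close>.

  The block recursion turns the identity for \<open>n\<close> into
  \<open>(z I - M\<^bsub>n+1\<^esub>) x(z) = (z C\<^sub>n(z)\<^sup>2 - 1) e\<^sub>1\<close>. The scalar on the right must then be the value of the
  characteristic polynomial, because \<open>M\<^bsub>n+1\<^esub>\<close> is an upper Hessenberg matrix with ones on the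
  subdiagonal: replacing the last column of \<open>z I - M\<^bsub>n+1\<^esub>\<close> by a combination of all columns in which
  it has coefficient \<open>1\<close> leaves the determinant alone, and expansion along the new column
  \<open>p e\<^sub>1\<close> leaves a triangular minor (lemma \<open>const_hessenberg_det\<close>). So the eigenvector identity and
  the recurrence \<open>C\<^bsub>n+1\<^esub>(z) = z C\<^sub>n(z)\<^sup>2 - 1\<close> are established by one and the same induction.

  The Hessenberg shape also gives uniqueness. Read from the bottom up, the rows of
  \<open>(z I - M\<^sub>n) y = 0\<close> determine each entry of \<open>y\<close> from the later ones, so that \<open>y\<close> is determined by its
  last entry (lemma \<open>const_hessenberg_kernel\<close>).

  Finally, \<open>\<rho>\<close> is given by a definite description, so a dominant eigenvalue has to be shown to
  exist. Instead of the Perron--Frobenius theorem, the recurrence is used: \<open>C\<^sub>n\<close> has a real root \<open>r\<close>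
  beyond which it increases strictly, and \<open>C\<^sub>n(\<bar>z\<bar>) < \<bar>C\<^sub>n(z)\<bar>\<close> whenever \<open>\<bar>z\<bar> \<ge> r\<close> and \<open>z\<close> is not a
  nonnegative real (lemma \<open>mandelbrot_iter_dominant_root\<close>). A root of modulus at least \<open>r\<close> can
  therefore only be \<open>r\<close> itself.
\<close>

section \<open>Hessenberg matrices with constant subdiagonal\<close>

definition const_hessenberg :: "'a :: zero \<Rightarrow> 'a mat \<Rightarrow> bool" where
  "const_hessenberg s A \<longleftrightarrow>
    (\<forall>i < dim_row A. \<forall>j < dim_col A.
       (j + 1 < i \<longrightarrow> A $$ (i, j) = 0) \<and> (i = j + 1 \<longrightarrow> A $$ (i, j) = s))"

text \<open>
  Column operations turn the last column of \<open>A\<close> into \<open>A x\<close> without changing the determinant, since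
  the last column enters \<open>A x\<close> with coefficient \<open>1\<close>. The only nonzero entry of the new column is at
  the top, and deleting it with its row and column shifts the subdiagonal of \<open>A\<close> to the diagonal of
  an upper triangular matrix.
\<close>

lemma const_hessenberg_det:
  fixes A :: "'a :: comm_ring_1 mat"
  assumes A: "A \<in> carrier_mat (Suc m) (Suc m)" and hess: "const_hessenberg s A"
    and x: "x \<in> carrier_vec (Suc m)" and last: "x $ m = 1"
    and Ax: "A *\<^sub>v x = p \<cdot>\<^sub>v unit_vec (Suc m) 0"
  shows "det A = p * (- s) ^ m"
proof -
  \<comment> \<open>the column operation: the identity matrix with last column \<open>x\<close>\<close>
  define B where "B = mat (Suc m) (Suc m) (\<lambda>(i, j). if j = m then x $ i else if i = j then 1 else 0)"
  define D where "D = A * B"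
  have B: "B \<in> carrier_mat (Suc m) (Suc m)" by (simp add: B_def)
  have D: "D \<in> carrier_mat (Suc m) (Suc m)" using A B by (simp add: D_def)
  have "upper_triangular B" by (rule upper_triangularI) (auto simp: B_def)
  hence "det B = prod_list (diag_mat B)" by (rule det_upper_triangular[OF _ B])
  also have "\<dots> = (\<Prod>i = 0..<Suc m. B $$ (i, i))" using B by (simp add: prod_list_diag_prod)
  also have "\<dots> = 1" by (rule prod.neutral) (auto simp: B_def last)
  finally have "det A = det D" using det_mult[OF A B] by (simp add: D_def)
  have col_last: "D $$ (i, m) = (if i = 0 then p else 0)" if "i < Suc m" for i
  proof -
    have "col B m = x" using x by (intro eq_vecI) (auto simp: B_def)
    hence "D $$ (i, m) = (A *\<^sub>v x) $ i" using A B that by (simp add: D_def)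
    thus ?thesis using that by (simp add: Ax)
  qed
  have col_other: "D $$ (i, j) = A $$ (i, j)" if "i < Suc m" "j < m" for i j
  proof -
    have "col B j = unit_vec (Suc m) j" using that by (intro eq_vecI) (auto simp: B_def)
    hence "D $$ (i, j) = row A i \<bullet> unit_vec (Suc m) j" using A B that by (simp add: D_def)
    thus ?thesis using A that by simp
  qed
  let ?E = "mat_delete D 0 m"
  have E: "?E \<in> carrier_mat m m" using mat_delete_carrier[OF D] by simp
  have E_entry: "?E $$ (i, j) = A $$ (Suc i, j)" if "i < m" "j < m" for i j
    using that D col_other[of "Suc i" j] by (simp add: mat_delete_def)
  have "upper_triangular ?E"
    using E hess A by (intro upper_triangularI) (auto simp: E_entry const_hessenberg_def)
  hence "det ?E = prod_list (diag_mat ?E)" by (rule det_upper_triangular[OF _ E])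
  also have "\<dots> = (\<Prod>i = 0..<m. ?E $$ (i, i))" using carrier_matD(1)[OF E] by (simp add: prod_list_diag_prod del: mat_delete_dim)
  also have "\<dots> = (\<Prod>i = 0..<m. s)"
    using hess A by (intro prod.cong) (auto simp: E_entry const_hessenberg_def)
  finally have detE: "det ?E = s ^ m" by simp
  have "det D = (\<Sum>i<Suc m. D $$ (i, m) * cofactor D i m)"
    by (rule laplace_expansion_column[OF D]) simp
  also have "\<dots> = (\<Sum>i<Suc m. if i = 0 then p * cofactor D 0 m else 0)"
    by (rule sum.cong) (auto simp: col_last)
  also have "\<dots> = p * cofactor D 0 m" by simp
  also have "\<dots> = p * (- s) ^ m"
    by (simp add: cofactor_def detE power_minus[of s])
  finally show ?thesis using \<open>det A = det D\<close> by simp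
qed

text \<open>
  Back substitution: in row \<open>i + 1\<close> of \<open>A y = 0\<close> only \<open>y $ i\<close>, with coefficient \<open>s\<close>, and later entries
  occur.
\<close>

lemma const_hessenberg_kernel:
  fixes A :: "'a :: idom mat"
  assumes A: "A \<in> carrier_mat (Suc m) (Suc m)" and hess: "const_hessenberg s A" and "s \<noteq> 0"
    and y: "y \<in> carrier_vec (Suc m)" and last: "y $ m = 0"
    and Ay: "A *\<^sub>v y = 0\<^sub>v (Suc m)"
  shows "y = 0\<^sub>v (Suc m)"
proof -
  have "\<forall>j. i \<le> j \<and> j \<le> m \<longrightarrow> y $ j = 0" if "i \<le> m" for i
    using that
  proof (induction i rule: inc_induct)
    case base
    show ?case using last by auto
  next
    case (step i)
    have "(A *\<^sub>v y) $ Suc i = (\<Sum>j = 0..<Suc m. A $$ (Suc i, j) * y $ j)"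
      using A y step.hyps by (simp add: scalar_prod_def)
    also have "\<dots> = (\<Sum>j = 0..<Suc m. if j = i then s * y $ i else 0)"
    proof (rule sum.cong)
      fix j assume "j \<in> {0..<Suc m}"
      moreover have "y $ j = 0" if "i < j" "j \<le> m" using step.IH that by auto
      moreover have "A $$ (Suc i, j) = 0" if "j < i" using hess A step.hyps that
        by (auto simp: const_hessenberg_def)
      moreover have "A $$ (Suc i, i) = s" using hess A step.hyps
        by (auto simp: const_hessenberg_def)
      ultimately show "A $$ (Suc i, j) * y $ j = (if j = i then s * y $ i else 0)"
        by (cases i j rule: linorder_cases) auto
    qed simp
    also have "\<dots> = s * y $ i" using step.hyps by simp
    finally have "y $ i = 0" using Ay step.hyps \<open>s \<noteq> 0\<close> by simp
    thus ?case using step.IH by (metis Suc_leI le_neq_implies_less)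
  qed
  from this[of 0] show ?thesis using y by (intro eq_vecI) auto
qed

section \<open>The block structure of the Mandelbrot matrices\<close>

lemma d_Suc: "d (Suc n) = Suc (2 * d n)"
proof -
  have "2 ^ n \<ge> (1 :: nat)" by simp
  thus ?thesis unfolding d_def power_Suc by linarith
qed

lemma d_pos: "d (Suc n) > 0"
  by (simp add: d_Suc)

lemma mandelbrot_mat_carrier: "mandelbrot_mat n \<in> carrier_mat (d n) (d n)"
proof (induction n rule: mandelbrot_mat.induct)
  case (3 k)
  have "four_block_mat (mandelbrot_mat (Suc k)) (0\<^sub>m (d (Suc k)) 1) (row_e_last (d (Suc k))) (0\<^sub>m 1 1)
      \<in> carrier_mat (d (Suc k) + 1) (d (Suc k) + 1)"
    using 3 by (intro four_block_carrier_mat) auto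
  from four_block_carrier_mat[OF this 3] show ?case
    by (simp add: Let_def d_Suc[of "Suc k"] mult_2)
qed (auto simp: d_def)

text \<open>
  The block form of the matrix acting on a vector cut into the same three blocks. The nested
  \<open>2 \<times> 2\<close> blocks of the definition are dealt with here once and for all.
\<close>

lemma mandelbrot_mat_mult:
  fixes c :: complex and k :: nat
  defines "m \<equiv> d (Suc k)" and "M \<equiv> mandelbrot_mat (Suc k)"
  assumes a: "a \<in> carrier_vec m" and b: "b \<in> carrier_vec m"
  shows "mandelbrot_mat (Suc (Suc k)) *\<^sub>v (a @\<^sub>v vec_of_list [c] @\<^sub>v b) =
    (M *\<^sub>v a + (b $ (m - 1)) \<cdot>\<^sub>v unit_vec m 0) @\<^sub>v vec_of_list [a $ (m - 1)]
      @\<^sub>v (c \<cdot>\<^sub>v unit_vec m 0 + M *\<^sub>v b)"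
proof -
  have m: "m > 0" by (simp add: m_def d_pos)
  have M: "M \<in> carrier_mat m m" unfolding M_def m_def by (rule mandelbrot_mat_carrier)
  have c: "vec_of_list [c] \<in> carrier_vec 1" by (simp add: carrier_vecI)
  have re: "row_e_last m \<in> carrier_mat 1 m" by (simp add: row_e_last_def mat_of_rows_def)
  have ce: "col_e1 m \<in> carrier_mat m 1" by (simp add: col_e1_def mat_of_cols_def)
  have re_mult: "row_e_last m *\<^sub>v v = vec_of_list [v $ (m - 1)]" if "v \<in> carrier_vec m" for v
  proof -
    have "row (row_e_last m) 0 = unit_vec m (m - 1)"
      by (intro eq_vecI) (auto simp: row_e_last_def mat_of_rows_def)
    thus ?thesis using that m re by (intro eq_vecI) auto
  qed
  have ce_mult: "col_e1 m *\<^sub>v vec_of_list [t] = t \<cdot>\<^sub>v unit_vec m 0" for t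
    by (intro eq_vecI) (auto simp: col_e1_def mat_of_cols_def vec_of_list_index row_def scalar_prod_def)
  let ?UL = "four_block_mat M (0\<^sub>m m 1) (row_e_last m) (0\<^sub>m 1 1)"
  let ?UR = "col_e1 m * row_e_last m @\<^sub>r 0\<^sub>m 1 m"
  let ?LL = "four_block_mat (0\<^sub>m m m) (col_e1 m) (0\<^sub>m 0 m) (0\<^sub>m 0 1)"
  have UL: "?UL \<in> carrier_mat (m + 1) (m + 1)" using M by (intro four_block_carrier_mat) auto
  have UR: "?UR \<in> carrier_mat (m + 1) m" using re ce by (intro carrier_append_rows) auto
  have "?LL \<in> carrier_mat (m + 0) (m + 1)" by (intro four_block_carrier_mat) auto
  hence LL: "?LL \<in> carrier_mat m (m + 1)" by simp
  have ac: "a @\<^sub>v vec_of_list [c] \<in> carrier_vec (m + 1)" using a c by (rule append_carrier_vec)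
  have 1: "?UL *\<^sub>v (a @\<^sub>v vec_of_list [c]) = M *\<^sub>v a @\<^sub>v vec_of_list [a $ (m - 1)]"
    using M re a c re_mult[OF a] by (subst four_block_mat_mult_vec[OF M _ re _ a c]) (auto intro!: eq_vecI simp: vec_of_list_index)
  have 2: "?UR *\<^sub>v b = (b $ (m - 1)) \<cdot>\<^sub>v unit_vec m 0 @\<^sub>v 0\<^sub>v 1"
  proof -
    have "?UR *\<^sub>v b = (col_e1 m * row_e_last m) *\<^sub>v b @\<^sub>v 0\<^sub>m 1 m *\<^sub>v b"
      using re ce b by (intro mat_mult_append) auto
    also have "(col_e1 m * row_e_last m) *\<^sub>v b = (b $ (m - 1)) \<cdot>\<^sub>v unit_vec m 0"
      using assoc_mult_mat_vec[OF ce re b] re_mult[OF b] ce_mult by simp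
    also have "0\<^sub>m 1 m *\<^sub>v b = 0\<^sub>v 1" using b by (auto intro!: eq_vecI)
    finally show ?thesis .
  qed
  have 3: "?LL *\<^sub>v (a @\<^sub>v vec_of_list [c]) = c \<cdot>\<^sub>v unit_vec m 0"
    using a c ce by (subst four_block_mat_mult_vec[OF _ ce _ _ a c]) (auto intro!: eq_vecI simp: ce_mult simp del: vec_of_list_Cons)
  have "mandelbrot_mat (Suc (Suc k)) *\<^sub>v (a @\<^sub>v vec_of_list [c] @\<^sub>v b)
      = four_block_mat ?UL ?UR ?LL M *\<^sub>v ((a @\<^sub>v vec_of_list [c]) @\<^sub>v b)"
  proof -
    have "a @\<^sub>v vec_of_list [c] @\<^sub>v b = (a @\<^sub>v vec_of_list [c]) @\<^sub>v b"
      by (intro eq_vecI) (auto simp: vec_index_vCons)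
    thus ?thesis by (simp only: mandelbrot_mat.simps Let_def M_def m_def)
  qed
  also have "\<dots> = (?UL *\<^sub>v (a @\<^sub>v vec_of_list [c]) + ?UR *\<^sub>v b)
      @\<^sub>v (?LL *\<^sub>v (a @\<^sub>v vec_of_list [c]) + M *\<^sub>v b)"
    by (rule four_block_mat_mult_vec[OF UL UR LL M ac b])
  also have "\<dots> = (M *\<^sub>v a + (b $ (m - 1)) \<cdot>\<^sub>v unit_vec m 0) @\<^sub>v vec_of_list [a $ (m - 1)]
      @\<^sub>v (c \<cdot>\<^sub>v unit_vec m 0 + M *\<^sub>v b)"
    unfolding 1 2 3 using a b M by (auto intro!: eq_vecI simp: vec_index_vCons)
  finally show ?thesis .
qed

text \<open>
  Below the diagonal blocks, the only nonzero entries are the last one of the row block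
  \<open>e\<^sub>d\<^sup>T\<close> and the first one of the column block \<open>e\<^sub>1\<close>; both lie on the subdiagonal and join those of
  the two copies of the smaller matrix.
\<close>

lemma mandelbrot_mat_hessenberg: "const_hessenberg 1 (mandelbrot_mat n)"
proof (induction n rule: mandelbrot_mat.induct)
  case (3 k)
  define m where "m = d (Suc k)"
  define M where "M = mandelbrot_mat (Suc k)"
  have m: "m > 0" by (simp add: m_def d_pos)
  have M: "M \<in> carrier_mat m m" unfolding M_def m_def by (rule mandelbrot_mat_carrier)
  have dims: "dim_row M = m" "dim_col M = m" using M by auto
  have h: "j + 1 < i \<Longrightarrow> M $$ (i, j) = 0" "i = j + 1 \<Longrightarrow> M $$ (i, j) = 1" if "i < m" "j < m" for i j
    using 3 dims that unfolding const_hessenberg_def M_def by auto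
  show ?case
    unfolding const_hessenberg_def mandelbrot_mat.simps Let_def M_def[symmetric] m_def[symmetric]
    using m by (auto simp: dims h append_rows_def row_e_last_def col_e1_def mat_of_rows_def
        mat_of_cols_def unit_vec_def)
qed (auto simp: const_hessenberg_def)

section \<open>The parametrised eigenvector\<close>

lemma eval_vec_xvec_step:
  "eval_vec (xvec (Suc (Suc k))) z =
    (z * poly (C (Suc k)) z) \<cdot>\<^sub>v eval_vec (xvec (Suc k)) z
      @\<^sub>v vec_of_list [poly (C (Suc k)) z] @\<^sub>v eval_vec (xvec (Suc k)) z"
  by (intro eq_vecI) (auto simp: eval_vec_def vec_index_vCons)

lemma eval_vec_xvec_carrier: "eval_vec (xvec n) z \<in> carrier_vec (d n)"
proof (induction n rule: mandelbrot_mat.induct)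
  case 1
  show ?case by (intro carrier_vecI) (simp add: d_def eval_vec_def)
next
  case 2
  show ?case by (intro carrier_vecI) (simp add: d_def eval_vec_def)
next
  case (3 k)
  hence "dim_vec (eval_vec (xvec (Suc k)) z) = d (Suc k)" by simp
  hence "dim_vec (eval_vec (xvec (Suc (Suc k))) z) = d (Suc k) + (1 + d (Suc k))"
    by (simp only: eval_vec_xvec_step index_append_vec index_smult_vec dim_vec_of_list) simp
  thus ?case by (intro carrier_vecI) (simp add: d_Suc[of "Suc k"])
qed

lemma eval_vec_xvec_last: "eval_vec (xvec (Suc k)) z $ (d (Suc k) - 1) = 1"
proof (induction k)
  case 0
  show ?case by (simp add: d_def eval_vec_def vec_of_list_index)
next
  case (Suc k)
  have "dim_vec (eval_vec (xvec (Suc k)) z) = d (Suc k)" using eval_vec_xvec_carrier[of "Suc k" z] by simp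
  thus ?case unfolding eval_vec_xvec_step d_Suc[of "Suc k"] using Suc d_pos[of k] by (simp add: vec_index_vCons)
qed

text \<open>
  The bridge from vectors to characteristic polynomials: the Hessenberg determinant formula for
  \<open>z I - M\<close>, whose subdiagonal entries are \<open>-1\<close>, so that all signs cancel.
\<close>

lemma poly_C_eqI:
  assumes x: "x \<in> carrier_vec (d (Suc k))" and last: "x $ (d (Suc k) - 1) = 1"
    and Mx: "mandelbrot_mat (Suc k) *\<^sub>v x = z \<cdot>\<^sub>v x - p \<cdot>\<^sub>v unit_vec (d (Suc k)) 0"
  shows "poly (C (Suc k)) z = p"
proof -
  define M where "M = mandelbrot_mat (Suc k)"
  obtain m where m: "d (Suc k) = Suc m" using d_pos[of k] gr0_conv_Suc by auto
  have M: "M \<in> carrier_mat (Suc m) (Suc m)" unfolding M_def m[symmetric] by (rule mandelbrot_mat_carrier)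
  define A where "A = - char_matrix M z"
  have A: "A \<in> carrier_mat (Suc m) (Suc m)" using M by (simp add: A_def)
  have "const_hessenberg 1 M" unfolding M_def by (rule mandelbrot_mat_hessenberg)
  hence hess: "const_hessenberg (- 1) A"
    using M by (auto simp: const_hessenberg_def A_def char_matrix_def)
  have "char_matrix M z *\<^sub>v x = M *\<^sub>v x + (- z) \<cdot>\<^sub>v x"
    unfolding char_matrix_def using M x m
    by (intro eq_vecI) (auto simp: add_scalar_prod_distrib[of _ "Suc m"])
  hence Ax: "A *\<^sub>v x = p \<cdot>\<^sub>v unit_vec (Suc m) 0"
    using M x m Mx uminus_mult_mat_vec[of x "char_matrix M z"]
    unfolding A_def M_def[symmetric] by (intro eq_vecI) (auto simp: char_matrix_def)
  have "poly (C (Suc k)) z = det A"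
    unfolding C_def M_def[symmetric] A_def by (rule char_poly_matrix[OF M])
  also have "\<dots> = p" using const_hessenberg_det[OF A hess _ _ Ax] x last by (simp add: m)
  finally show ?thesis .
qed

lemma mandelbrot_mat_mult_xvec_1:
  "mandelbrot_mat (Suc 0) *\<^sub>v eval_vec (xvec (Suc 0)) z =
     z \<cdot>\<^sub>v eval_vec (xvec (Suc 0)) z - (z - 1) \<cdot>\<^sub>v unit_vec (d (Suc 0)) 0"
  by (intro eq_vecI) (auto simp: d_def eval_vec_def vec_of_list_index scalar_prod_def)

lemma poly_C_1: "poly (C (Suc 0)) z = z - 1"
  by (rule poly_C_eqI[OF eval_vec_xvec_carrier eval_vec_xvec_last mandelbrot_mat_mult_xvec_1])

text \<open>
  Both facts come from a single induction: the vector identity at one level yields the vector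
  identity at the next level with \<open>z * c\<^sup>2 - 1\<close> in place of the characteristic polynomial, and
  lemma \<open>poly_C_eqI\<close> then identifies this scalar.
\<close>

lemma mandelbrot_mat_mult_xvec:
  "mandelbrot_mat (Suc k) *\<^sub>v eval_vec (xvec (Suc k)) z =
     z \<cdot>\<^sub>v eval_vec (xvec (Suc k)) z - poly (C (Suc k)) z \<cdot>\<^sub>v unit_vec (d (Suc k)) 0"
  and poly_C_Suc_Suc: "poly (C (Suc (Suc k))) z = z * (poly (C (Suc k)) z)\<^sup>2 - 1"
proof -
  have step: "mandelbrot_mat (Suc (Suc k)) *\<^sub>v eval_vec (xvec (Suc (Suc k))) z =
     z \<cdot>\<^sub>v eval_vec (xvec (Suc (Suc k))) z
       - (z * (poly (C (Suc k)) z)\<^sup>2 - 1) \<cdot>\<^sub>v unit_vec (d (Suc (Suc k))) 0"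
    if IH: "mandelbrot_mat (Suc k) *\<^sub>v eval_vec (xvec (Suc k)) z =
     z \<cdot>\<^sub>v eval_vec (xvec (Suc k)) z - poly (C (Suc k)) z \<cdot>\<^sub>v unit_vec (d (Suc k)) 0" for k
  proof -
    define m where "m = d (Suc k)"
    define x where "x = eval_vec (xvec (Suc k)) z"
    define M where "M = mandelbrot_mat (Suc k)"
    define c where "c = poly (C (Suc k)) z"
    have m: "m > 0" by (simp add: m_def d_pos)
    have M: "M \<in> carrier_mat m m" unfolding M_def m_def by (rule mandelbrot_mat_carrier)
    have x: "x \<in> carrier_vec m" unfolding x_def m_def by (rule eval_vec_xvec_carrier)
    have last: "x $ (m - Suc 0) = 1" using eval_vec_xvec_last[of k z] by (simp add: m_def x_def)
    have Mx: "M *\<^sub>v x = z \<cdot>\<^sub>v x - c \<cdot>\<^sub>v unit_vec m 0"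
      using IH by (simp add: m_def x_def M_def c_def)
    have Mcx: "M *\<^sub>v (t \<cdot>\<^sub>v x) = t \<cdot>\<^sub>v (z \<cdot>\<^sub>v x - c \<cdot>\<^sub>v unit_vec m 0)" for t
      using mult_mat_vec[OF M x] Mx by simp
    have cx: "(z * c) \<cdot>\<^sub>v x \<in> carrier_vec m" using x by simp
    note mult = mandelbrot_mat_mult[where k = k, folded m_def M_def, OF cx x, of c]
    define q where "q = z * c\<^sup>2 - 1"
    have top: "M *\<^sub>v ((z * c) \<cdot>\<^sub>v x) + (x $ (m - 1)) \<cdot>\<^sub>v unit_vec m 0
        = z \<cdot>\<^sub>v ((z * c) \<cdot>\<^sub>v x) - q \<cdot>\<^sub>v unit_vec m 0"
      unfolding Mcx using x m last
      by (intro eq_vecI) (auto simp: q_def algebra_simps power2_eq_square)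
    have mid: "((z * c) \<cdot>\<^sub>v x) $ (m - 1) = z * c"
      using x m last by simp
    have bottom: "c \<cdot>\<^sub>v unit_vec m 0 + M *\<^sub>v x = z \<cdot>\<^sub>v x"
      unfolding Mx using x by (intro eq_vecI) auto
    have "(z \<cdot>\<^sub>v ((z * c) \<cdot>\<^sub>v x) - q \<cdot>\<^sub>v unit_vec m 0) @\<^sub>v vec_of_list [z * c] @\<^sub>v z \<cdot>\<^sub>v x
        = z \<cdot>\<^sub>v ((z * c) \<cdot>\<^sub>v x @\<^sub>v vec_of_list [c] @\<^sub>v x) - q \<cdot>\<^sub>v unit_vec (Suc (2 * m)) 0"
      using x m by (intro eq_vecI) (auto simp: vec_index_vCons unit_vec_def)
    thus ?thesis
      unfolding eval_vec_xvec_step d_Suc[of "Suc k"] m_def[symmetric] x_def[symmetric] c_def[symmetric]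
        mult q_def[symmetric] top mid bottom .
  qed
  have C: "poly (C (Suc (Suc k))) z = z * (poly (C (Suc k)) z)\<^sup>2 - 1"
    if "mandelbrot_mat (Suc k) *\<^sub>v eval_vec (xvec (Suc k)) z =
     z \<cdot>\<^sub>v eval_vec (xvec (Suc k)) z - poly (C (Suc k)) z \<cdot>\<^sub>v unit_vec (d (Suc k)) 0" for k
    by (rule poly_C_eqI[OF eval_vec_xvec_carrier eval_vec_xvec_last step[OF that]])
  show *: "mandelbrot_mat (Suc k) *\<^sub>v eval_vec (xvec (Suc k)) z =
     z \<cdot>\<^sub>v eval_vec (xvec (Suc k)) z - poly (C (Suc k)) z \<cdot>\<^sub>v unit_vec (d (Suc k)) 0" for k
  proof (induction k)
    case 0
    show ?case using mandelbrot_mat_mult_xvec_1[of z] by (simp only: poly_C_1)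
  next
    case (Suc k)
    show ?case unfolding C[OF Suc] by (rule step[OF Suc])
  qed
  show "poly (C (Suc (Suc k))) z = z * (poly (C (Suc k)) z)\<^sup>2 - 1" by (rule C[OF *])
qed

section \<open>The dominant root\<close>

text \<open>
  The values of the characteristic polynomials, with the argument in an arbitrary ring, so that
  the real function and the complex one can be compared.
\<close>

fun mandelbrot_iter :: "nat \<Rightarrow> 'a :: comm_ring_1 \<Rightarrow> 'a" where
  "mandelbrot_iter 0 z = 1"
| "mandelbrot_iter (Suc n) z = z * (mandelbrot_iter n z)\<^sup>2 - 1"

lemma poly_C_eq_mandelbrot_iter: "poly (C (Suc k)) z = mandelbrot_iter (Suc k) z"
proof (induction k)
  case 0
  show ?case by (simp add: poly_C_1)
qed (simp add: poly_C_Suc_Suc)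

lemma mandelbrot_iter_of_real: "mandelbrot_iter n (of_real t :: complex) = of_real (mandelbrot_iter n t)"
  by (induction n) auto

text \<open>
  All levels take the value \<open>1\<close> at \<open>2\<close>, because \<open>2 * 1\<^sup>2 - 1 = 1\<close>. So \<open>2\<close> serves at every level as the
  right end point for the intermediate value theorem.
\<close>

lemma mandelbrot_iter_2: "mandelbrot_iter n (2 :: real) = 1"
  by (induction n) auto

lemma continuous_on_mandelbrot_iter:
  "continuous_on S (mandelbrot_iter n :: real \<Rightarrow> real)"
proof (induction n)
  case 0
  have "mandelbrot_iter 0 = (\<lambda>_ :: real. 1 :: real)" by auto
  thus ?case by simp
next
  case (Suc n)
  have "mandelbrot_iter (Suc n) = (\<lambda>t :: real. t * (mandelbrot_iter n t)\<^sup>2 - 1)" by auto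
  thus ?case using Suc by (auto intro!: continuous_intros)
qed

text \<open>
  Induction on the level. At the root \<open>r\<close> of one level the next function takes the value \<open>-1\<close>, so
  its own root \<open>r'\<close> lies to the right of \<open>r\<close>, where the old function is nonnegative and increasing;
  squaring and multiplying by the argument preserve this. On \<open>\<bar>z\<bar> \<ge> r'\<close> the strict comparison of
  moduli passes to the next level by the triangle inequality
  \<open>\<bar>z w\<^sup>2 - 1\<bar> \<ge> \<bar>z\<bar> \<bar>w\<bar>\<^sup>2 - 1\<close>, and at the first level it is the strict case of
  \<open>\<bar>z - 1\<bar> \<ge> \<bar>z\<bar> - 1\<close>.
\<close>

lemma mandelbrot_iter_dominant_root:
  obtains r :: real where "0 < r" "r < 2" "mandelbrot_iter (Suc k) r = 0"
    "strict_mono_on {r..} (mandelbrot_iter (Suc k))"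
    "\<And>z :: complex. r \<le> cmod z \<Longrightarrow> z \<noteq> of_real (cmod z) \<Longrightarrow>
       mandelbrot_iter (Suc k) (cmod z) < cmod (mandelbrot_iter (Suc k) z)"
proof (induction k arbitrary: thesis)
  case 0
  show ?case
  proof (rule 0[of 1])
    fix z :: complex assume z: "1 \<le> cmod z" "z \<noteq> of_real (cmod z)"
    have "Re z \<noteq> cmod z"
    proof
      assume "Re z = cmod z"
      hence "Im z = 0" using cmod_power2[of z] by simp
      thus False using z \<open>Re z = cmod z\<close> by (simp add: complex_eq_iff)
    qed
    hence "Re z < cmod z" using complex_Re_le_cmod[of z] by simp
    hence "(cmod z - 1)\<^sup>2 < (cmod (z - 1))\<^sup>2"
      using cmod_power2[of z] cmod_power2[of "z - 1"] by (simp add: power2_eq_square algebra_simps)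
    hence "cmod z - 1 < cmod (z - 1)" by (rule power2_less_imp_less) simp
    thus "mandelbrot_iter (Suc 0) (cmod z) < cmod (mandelbrot_iter (Suc 0) z)" by simp
  qed (auto simp: strict_mono_on_def)
next
  case (Suc k)
  let ?f = "mandelbrot_iter (Suc k) :: real \<Rightarrow> real"
  let ?g = "mandelbrot_iter (Suc (Suc k)) :: real \<Rightarrow> real"
  obtain r :: real where r: "0 < r" "r < 2" "?f r = 0" "strict_mono_on {r..} ?f"
    "\<And>z :: complex. r \<le> cmod z \<Longrightarrow> z \<noteq> of_real (cmod z) \<Longrightarrow> ?f (cmod z) < cmod (mandelbrot_iter (Suc k) z)"
    using Suc.IH by blast
  have nonneg: "?f t \<ge> 0" if "r \<le> t" for t
    using strict_mono_onD[OF r(4), of r t] r(3) that by (cases "r = t") auto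
  have g: "?g t = t * (?f t)\<^sup>2 - 1" for t by simp
  have mono: "strict_mono_on {r..} ?g"
  proof (rule strict_mono_onI)
    fix s t assume st: "s \<in> {r..}" "t \<in> {r..}" "s < t"
    have "?f s < ?f t" using strict_mono_onD[OF r(4) st] .
    moreover have "0 \<le> ?f s" using nonneg st by simp
    ultimately have "(?f s)\<^sup>2 < (?f t)\<^sup>2" by (intro power_strict_mono) auto
    hence "s * (?f s)\<^sup>2 < t * (?f t)\<^sup>2"
      using st r(1) by (intro mult_strict_mono) auto
    thus "?g s < ?g t" unfolding g by simp
  qed
  have "?g r \<le> 0" unfolding g r(3) by simp
  moreover have "0 \<le> ?g 2" unfolding mandelbrot_iter_2 by simp
  ultimately obtain r' where r': "r \<le> r'" "r' \<le> 2" "?g r' = 0"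
    using IVT'[of ?g r 0 2] r(2) continuous_on_mandelbrot_iter[of _ "Suc (Suc k)"] by auto
  show ?case
  proof (rule Suc.prems[OF _ _ r'(3)])
    show "0 < r'" using r(1) r'(1) by simp
    show "r' < 2" using r'(2,3) mandelbrot_iter_2[of "Suc (Suc k)"] by (cases "r' = 2") auto
    show "strict_mono_on {r'..} ?g" using mono r'(1) unfolding strict_mono_on_def by auto
    fix z :: complex assume z: "r' \<le> cmod z" "z \<noteq> of_real (cmod z)"
    let ?w = "mandelbrot_iter (Suc k) z"
    have "?f (cmod z) < cmod ?w" using r(5) z r'(1) by simp
    hence "(?f (cmod z))\<^sup>2 < (cmod ?w)\<^sup>2"
      using nonneg[of "cmod z"] z(1) r'(1) by (intro power_strict_mono) auto
    hence "cmod z * (?f (cmod z))\<^sup>2 < cmod z * (cmod ?w)\<^sup>2"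
      using z(1) r(1) r'(1) by (intro mult_strict_left_mono) auto
    hence "?g (cmod z) < cmod (z * ?w\<^sup>2) - 1" by (simp add: norm_mult norm_power)
    also have "\<dots> \<le> cmod (z * ?w\<^sup>2 - 1)" using norm_triangle_ineq2[of "z * ?w\<^sup>2" 1] by simp
    finally show "?g (cmod z) < cmod (mandelbrot_iter (Suc (Suc k)) z)" by simp
  qed
qed

lemma is_dominant_eigenvalue_unique:
  assumes "is_dominant_eigenvalue A r" "is_dominant_eigenvalue A s"
  shows "r = s"
proof (rule ccontr)
  assume "r \<noteq> s"
  hence "cmod s < cmod r" "cmod r < cmod s"
    using assms unfolding is_dominant_eigenvalue_def by auto
  thus False by simp
qed

text \<open>
  The real root of lemma \<open>mandelbrot_iter_dominant_root\<close> is a dominant eigenvalue, hence the one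
  that the definite description \<open>\<rho>\<close> picks out.
\<close>

lemma poly_C_rho: "poly (C (Suc k)) (\<rho> (Suc k)) = 0"
proof -
  have ev: "eigenvalue (mandelbrot_mat (Suc k)) z \<longleftrightarrow> mandelbrot_iter (Suc k) z = 0" for z
    using eigenvalue_root_char_poly[OF mandelbrot_mat_carrier, of "Suc k" z]
    unfolding C_def[symmetric] poly_C_eq_mandelbrot_iter .
  obtain r :: real where r: "0 < r" "r < 2" "mandelbrot_iter (Suc k) r = 0"
    "strict_mono_on {r..} (mandelbrot_iter (Suc k))"
    "\<And>z :: complex. r \<le> cmod z \<Longrightarrow> z \<noteq> of_real (cmod z) \<Longrightarrow>
       mandelbrot_iter (Suc k) (cmod z) < cmod (mandelbrot_iter (Suc k) z)"
    using mandelbrot_iter_dominant_root[of k] by metis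
  have "cmod s < r" if s: "mandelbrot_iter (Suc k) s = 0" "s \<noteq> of_real r" for s :: complex
  proof (rule ccontr)
    assume "\<not> cmod s < r"
    hence ge: "r \<le> cmod s" by simp
    have nonneg: "0 \<le> mandelbrot_iter (Suc k) (cmod s)"
      using strict_mono_onD[OF r(4), of r "cmod s"] r(3) ge by (cases "r = cmod s") auto
    show False
    proof (cases "s = of_real (cmod s)")
      case True
      hence "r < cmod s" using s(2) ge by (cases "r = cmod s") auto
      hence "0 < mandelbrot_iter (Suc k) (cmod s)"
        using strict_mono_onD[OF r(4), of r "cmod s"] r(3) by simp
      moreover have "complex_of_real (mandelbrot_iter (Suc k) (cmod s)) = 0"
        using s(1) True mandelbrot_iter_of_real[of "Suc k" "cmod s"] by metis
      ultimately show False by (metis of_real_eq_0_iff less_irrefl)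
    next
      case False
      from r(5)[OF ge this] nonneg show False unfolding s(1) norm_zero by linarith
    qed
  qed
  moreover have "mandelbrot_iter (Suc k) (of_real r :: complex) = 0"
    using mandelbrot_iter_of_real[of "Suc k" r] r(3) by (metis of_real_0)
  ultimately have dom: "is_dominant_eigenvalue (mandelbrot_mat (Suc k)) (of_real r)"
    unfolding is_dominant_eigenvalue_def ev using r(1) by auto
  hence "is_dominant_eigenvalue (mandelbrot_mat (Suc k)) (\<rho> (Suc k))"
    unfolding \<rho>_def by (rule theI) (rule is_dominant_eigenvalue_unique[OF _ dom])
  thus ?thesis
    unfolding is_dominant_eigenvalue_def ev poly_C_eq_mandelbrot_iter by simp
qed

section \<open>The eigenvector\<close>

text \<open>
  Two normalized eigenvectors for the same eigenvalue differ by a kernel vector with last entry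
  \<open>0\<close>, which vanishes by back substitution.
\<close>

lemma normalized_eigenvector_mandelbrot_mat:
  assumes root: "poly (C (Suc k)) z = 0"
  shows "eigenvector (mandelbrot_mat (Suc k)) y z \<and> y $ (d (Suc k) - 1) = 1
    \<longleftrightarrow> y = eval_vec (xvec (Suc k)) z"
proof -
  define M where "M = mandelbrot_mat (Suc k)"
  define x where "x = eval_vec (xvec (Suc k)) z"
  obtain m where m: "d (Suc k) = Suc m" using d_pos[of k] gr0_conv_Suc by auto
  have M: "M \<in> carrier_mat (Suc m) (Suc m)" unfolding M_def m[symmetric] by (rule mandelbrot_mat_carrier)
  have x: "x \<in> carrier_vec (Suc m)" unfolding x_def m[symmetric] by (rule eval_vec_xvec_carrier)
  have last: "x $ m = 1" using eval_vec_xvec_last[of k z] by (simp add: m x_def)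
  have "M *\<^sub>v x = z \<cdot>\<^sub>v x"
    using mandelbrot_mat_mult_xvec[of k z] x unfolding root M_def[symmetric] x_def[symmetric] m
    by (intro eq_vecI) auto
  moreover have "x \<noteq> 0\<^sub>v (Suc m)" using last by auto
  ultimately have ev: "eigenvector M x z" unfolding eigenvector_def using M x by simp
  have "y = x" if y: "eigenvector M y z" "y $ m = 1"
  proof -
    let ?A = "char_matrix M z"
    have A: "?A \<in> carrier_mat (Suc m) (Suc m)" using M by simp
    have hess: "const_hessenberg 1 ?A"
      using mandelbrot_mat_hessenberg[of "Suc k"] M
      by (auto simp: const_hessenberg_def char_matrix_def M_def[symmetric])
    have yc: "y \<in> carrier_vec (Suc m)" and Ay: "?A *\<^sub>v y = 0\<^sub>v (Suc m)"
      using y(1) unfolding eigenvector_char_matrix[OF M] by auto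
    have "?A *\<^sub>v x = 0\<^sub>v (Suc m)" using ev unfolding eigenvector_char_matrix[OF M] by auto
    hence "?A *\<^sub>v (y - x) = 0\<^sub>v (Suc m)" using mult_minus_distrib_mat_vec[OF A yc x] Ay by simp
    moreover have "(y - x) $ m = 0" using x last y(2) by simp
    ultimately have "y - x = 0\<^sub>v (Suc m)"
      using const_hessenberg_kernel[OF A hess] x yc by simp
    hence "(y - x) $ i = 0" if "i < Suc m" for i using that by simp
    thus "y = x" using x yc by (intro eq_vecI) auto
  qed
  thus ?thesis using ev last unfolding M_def[symmetric] x_def[symmetric] m by auto
qed

theorem theorem1:
  fixes n :: nat
  assumes "n \<ge> 1"
  shows "{y. eigenvector (mandelbrot_mat (n + 1)) y (\<rho> (n + 1)) \<and> y $ (d (n + 1) - 1) = 1}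
           = {eval_vec (xvec (n + 1)) (\<rho> (n + 1))} \<and>
         eval_vec (xvec (n + 1)) (\<rho> (n + 1)) =
           (\<rho> (n + 1) * poly (C n) (\<rho> (n + 1))) \<cdot>\<^sub>v eval_vec (xvec n) (\<rho> (n + 1))
             @\<^sub>v vec_of_list [poly (C n) (\<rho> (n + 1))]
             @\<^sub>v eval_vec (xvec n) (\<rho> (n + 1))"
proof
  show "{y. eigenvector (mandelbrot_mat (n + 1)) y (\<rho> (n + 1)) \<and> y $ (d (n + 1) - 1) = 1}
      = {eval_vec (xvec (n + 1)) (\<rho> (n + 1))}"
    using normalized_eigenvector_mandelbrot_mat[OF poly_C_rho, of n] by auto
  obtain k where "n = Suc k" using assms by (cases n) auto
  thus "eval_vec (xvec (n + 1)) (\<rho> (n + 1)) =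
      (\<rho> (n + 1) * poly (C n) (\<rho> (n + 1))) \<cdot>\<^sub>v eval_vec (xvec n) (\<rho> (n + 1))
        @\<^sub>v vec_of_list [poly (C n) (\<rho> (n + 1))]
        @\<^sub>v eval_vec (xvec n) (\<rho> (n + 1))"
    using eval_vec_xvec_step[of k] by simp
qed

end
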